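(* The following hold. (a) If $(X,\|\cdot\|)$ is a real seminormed vector space, then $(X,\|\cdot\|,\langle\cdot|\cdot\rangle_\spadesuit)$ fulfils the CSB inequality, i.e. $|\langle\vec{x}|\vec{y}\rangle_\spadesuit|\le\|\vec{x}\|\cdot\|\vec{y}\|$ for all $\vec{x},\vec{y}\in X$; hence $\angle_{Thy}(\vec{x},\vec{y})$ is defined for all $\vec{x},\vec{y}\in X$ with $\|\vec{x}\|\cdot\|\vec{y}\|\neq 0$. (b) If $(X,\|\cdot\|)$ is a real seminormed vector space, then $(X,\|\cdot\|,\angle_{Thy})$ fulfils (An 1), (An 2), (An 3), (An 4), (An 5); hence $(X,\|\cdot\|,\angle_{Thy})$ is an angle space. (c) If $(X,\|\cdot\|)$ is a real seminormed vector space, then $(X,\|\cdot\|,\angle_{Thy})$ fulfils (An 6) and (An 7). (d) If $(X,\langle\cdot|\cdot\rangle_{IP})$ is a real inner product space with associated norm $\|\vec{x}\|=\sqrt{\langle\vec{x}|\vec{x}\rangle_{IP}}$, then $(X,\|\cdot\|,\langle\cdot|\cdot\rangle_{IP})$ fulfils the CSB inequality, i.e. $|\langle\vec{x}|\vec{y}\rangle_{IP}|\le\|\vec{x}\|\cdot\|\vec{y}\|$ for all $\vec x,\vec y\in X$, and for all $\vec{x},\vec{y}\neq\vec{0}$ we have $\angle_{Thy}(\vec{x},\vec{y})=\angle_{Euclid}(\vec{x},\vec{y})$. (e) For real normed vector spaces $(X,\|\cdot\|)$, the triple $(X,\|\cdot\|,\angle_{Thy})$ in general does not fulfil (An 8),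 (An 9), (An 10): for each of these three conditions there is a real normed vector space for which it fails. (f) For real seminormed vector spaces $(X,\|\cdot\|)$, the triple $(X,\|\cdot\|,\angle_{Thy})$ in general does not fulfil (An 8), (An 9), (An 10), (An 11): for each of these four conditions there is a real seminormed vector space for which it fails.
   Context: A homogeneously weighted vector space (hw space) is a real topological vector space $X$ with a continuous map $\|\cdot\|:X\to[0,\infty)$ satisfying $\|r\vec{x}\|=|r|\,\|\vec{x}\|$ for all $r\in\mathbb{R}$, $\vec{x}\in X$. It is a seminormed (resp. normed) vector space if $\|\cdot\|$ moreover is a seminorm (resp. a norm). Its zero-set is $\mathsf{Z}=\{\vec{x}\in X:\|\vec{x}\|=0\}$. On a hw space define $\langle\vec{x}|\vec{y}\rangle_\spadesuit:=0$ if $\|\vec{x}\|\cdot\|\vec{y}\|=0$, and otherwise $$\langle\vec{x}|\vec{y}\rangle_\spadesuit:=\frac14\,\|\vec{x}\|\,\|\vec{y}\|\left[\left\|\frac{\vec{x}}{\|\vec{x}\|}+\frac{\vec{y}}{\|\vec{y}\|}\right\|^2-\left\|\frac{\vec{x}}{\|\vec{x}\|}-\frac{\vec{y}}{\|\vec{y}\|}\right\|^2\right].$$ For $\vec{x},\vec{y}\in X\setminus\mathsf{Z}$ with $|\langle\vec{x}|\vec{y}\rangle_\spadesuit|\le\|\vec{x}\|\,\|\vec{y}\|$ the Thy angle is $\angle_{Thy}(\vec{x},\vec{y}):=\arccos\frac{\langle\vec{x}|\vec{y}\rangle_\spadesuit}{\|\vec{x}\|\,\|\vec{y}\|}$. In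 an inner product space, $\angle_{Euclid}(\vec{x},\vec{y}):=\arccos\frac{\langle\vec{x}|\vec{y}\rangle_{IP}}{\|\vec{x}\|\,\|\vec{y}\|}$ for $\vec{x},\vec{y}\ne\vec{0}$. For a hw space $(X,\|\cdot\|)$ and an angle $\angle_X$ consider the conditions: (An 1) $\angle_X$ is a continuous function from $[X\setminus\mathsf{Z}]^2$ into $[0,\pi]$. (An 2) $\angle_X(\vec{x},\vec{x})=0$ for all $\vec{x}\in X\setminus\mathsf{Z}$. (An 3) $\angle_X(-\vec{x},\vec{x})=\pi$ for all $\vec{x}\in X\setminus\mathsf{Z}$. (An 4) $\angle_X(\vec{x},\vec{y})=\angle_X(\vec{y},\vec{x})$ for all $\vec{x},\vec{y}\in X\setminus\mathsf{Z}$. (An 5) $\angle_X(r\vec{x},s\vec{y})=\angle_X(\vec{x},\vec{y})$ for all $\vec{x},\vec{y}\in X\setminus\mathsf{Z}$ and $r,s>0$. (An 6) $\angle_X(-\vec{x},-\vec{y})=\angle_X(\vec{x},\vec{y})$ for all $\vec{x},\vec{y}\in X\setminus\mathsf{Z}$. (An 7) $\angle_X(\vec{x},\vec{y})+\angle_X(-\vec{x},\vec{y})=\pi$ for all $\vec{x},\vec{y}\in X\setminus\mathsf{Z}$. (An 8) $\angle_X(\vec{x},\vec{x}+\vec{y})+\angle_X(\vec{x}+\vec{y},\vec{y})=\angle_X(\vec{x},\vec{y})$ for all $\vec{x},\vec{y},\vec{x}+\vec{y}\in X\setminus\mathsf{Z}$. (An 9) $\angle_X(\vec{x},\vec{y})+\angle_X(-\vec{x},\vec{y}-\vec{x})+\angle_X(-\vec{y},\vec{x}-\vec{y})=\pi$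 for all $\vec{x},\vec{y},\vec{x}-\vec{y}\in X\setminus\mathsf{Z}$. (An 10) $\angle_X(\vec{y},\vec{y}-\vec{x})+\angle_X(\vec{x},\vec{x}-\vec{y})=\angle_X(-\vec{x},\vec{y})$ for all $\vec{x},\vec{y},\vec{x}-\vec{y}\in X\setminus\mathsf{Z}$. (An 11) For any two linearly independent vectors $\vec{x},\vec{y}\in X\setminus\mathsf{Z}$ the assignment $t\mapsto\angle_X(\vec{x},\vec{y}+t\vec{x})$ is (well defined and) a decreasing homeomorphism $\mathbb{R}\to(0,\pi)$. The triple $(X,\|\cdot\|,\angle_X)$ is called an angle space if (An 1)–(An 5) hold. *)

theory Defs
  imports "HOL-Analysis.Analysis"
begin

text \<open>Topological vector spaces are not assumed to be Hausdorff: a seminorm topology need not be.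
  The axiom is joint continuity of scalar multiplication at \<open>(r, x)\<close>.\<close>

class real_topological_vector_space = real_vector + topological_ab_group_add +
  assumes tendsto_scaleR_Pair:
    "LIM p (nhds r \<times>\<^sub>F nhds x). fst p *\<^sub>R snd p :> nhds (r *\<^sub>R x)"

instance real_normed_vector < real_topological_vector_space
  by standard (intro tendsto_scaleR filterlim_fst filterlim_snd)

text \<open>The weight is a function \<open>N\<close> on the type; the topology is that of the type, and only
  continuity of \<open>N\<close> relates the two (the topology may be finer than the one induced by \<open>N\<close>).\<close>

locale hw_space =
  fixes N :: "'a :: real_topological_vector_space \<Rightarrow> real"
  assumes continuous_weight: "continuous_on UNIV N"
    and weight_nonneg: "0 \<le> N x"
    and weight_scaleR: "N (r *\<^sub>R x) = \<bar>r\<bar> * N x"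

locale seminormed_space = hw_space +
  assumes weight_triangle: "N (x + y) \<le> N x + N y"

locale normed_space = seminormed_space +
  assumes weight_eq_0: "N x = 0 \<Longrightarrow> x = 0"

definition zero_set :: "('a \<Rightarrow> real) \<Rightarrow> 'a set" where
  "zero_set N = {x. N x = 0}"

definition spade_product :: "('a :: real_vector \<Rightarrow> real) \<Rightarrow> 'a \<Rightarrow> 'a \<Rightarrow> real" where
  "spade_product N x y =
    (if N x * N y = 0 then 0
     else 1 / 4 * N x * N y *
       ((N (x /\<^sub>R N x + y /\<^sub>R N y))\<^sup>2 - (N (x /\<^sub>R N x - y /\<^sub>R N y))\<^sup>2))"

definition CSB_inequality :: "('a \<Rightarrow> real) \<Rightarrow> ('a \<Rightarrow> 'a \<Rightarrow> real) \<Rightarrow> bool" where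
  "CSB_inequality N p \<longleftrightarrow> (\<forall>x y. \<bar>p x y\<bar> \<le> N x * N y)"

text \<open>\<open>thy_angle\<close> is a total function that is meaningful only where \<open>thy_angle_defined\<close> holds;
  outside \<open>[-1, 1]\<close> the value of \<^const>\<open>arccos\<close> is unspecified.\<close>

definition thy_angle_defined :: "('a :: real_vector \<Rightarrow> real) \<Rightarrow> 'a \<Rightarrow> 'a \<Rightarrow> bool" where
  "thy_angle_defined N x y \<longleftrightarrow>
    x \<notin> zero_set N \<and> y \<notin> zero_set N \<and> \<bar>spade_product N x y\<bar> \<le> N x * N y"

definition thy_angle :: "('a :: real_vector \<Rightarrow> real) \<Rightarrow> 'a \<Rightarrow> 'a \<Rightarrow> real" where
  "thy_angle N x y = arccos (spade_product N x y / (N x * N y))"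

definition euclid_angle :: "'a :: real_inner \<Rightarrow> 'a \<Rightarrow> real" where
  "euclid_angle x y = arccos (inner x y / (norm x * norm y))"

text \<open>In the following conditions an angle is a function on \<open>(- zero_set N) \<times> (- zero_set N)\<close>;
  its values elsewhere are never used.\<close>

definition An1 :: "('a :: topological_space \<Rightarrow> real) \<Rightarrow> ('a \<Rightarrow> 'a \<Rightarrow> real) \<Rightarrow> bool" where
  "An1 N ang \<longleftrightarrow>
    (\<forall>x\<in>- zero_set N. \<forall>y\<in>- zero_set N. ang x y \<in> {0..pi}) \<and>
    continuous_on ((- zero_set N) \<times> (- zero_set N)) (\<lambda>(x, y). ang x y)"

definition An2 :: "('a \<Rightarrow> real) \<Rightarrow> ('a \<Rightarrow> 'a \<Rightarrow> real) \<Rightarrow> bool" where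
  "An2 N ang \<longleftrightarrow> (\<forall>x\<in>- zero_set N. ang x x = 0)"

definition An3 :: "('a :: real_vector \<Rightarrow> real) \<Rightarrow> ('a \<Rightarrow> 'a \<Rightarrow> real) \<Rightarrow> bool" where
  "An3 N ang \<longleftrightarrow> (\<forall>x\<in>- zero_set N. ang (- x) x = pi)"

definition An4 :: "('a \<Rightarrow> real) \<Rightarrow> ('a \<Rightarrow> 'a \<Rightarrow> real) \<Rightarrow> bool" where
  "An4 N ang \<longleftrightarrow> (\<forall>x\<in>- zero_set N. \<forall>y\<in>- zero_set N. ang x y = ang y x)"

definition An5 :: "('a :: real_vector \<Rightarrow> real) \<Rightarrow> ('a \<Rightarrow> 'a \<Rightarrow> real) \<Rightarrow> bool" where
  "An5 N ang \<longleftrightarrow>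
    (\<forall>x\<in>- zero_set N. \<forall>y\<in>- zero_set N. \<forall>r>0. \<forall>s>0. ang (r *\<^sub>R x) (s *\<^sub>R y) = ang x y)"

definition An6 :: "('a :: real_vector \<Rightarrow> real) \<Rightarrow> ('a \<Rightarrow> 'a \<Rightarrow> real) \<Rightarrow> bool" where
  "An6 N ang \<longleftrightarrow> (\<forall>x\<in>- zero_set N. \<forall>y\<in>- zero_set N. ang (- x) (- y) = ang x y)"

definition An7 :: "('a :: real_vector \<Rightarrow> real) \<Rightarrow> ('a \<Rightarrow> 'a \<Rightarrow> real) \<Rightarrow> bool" where
  "An7 N ang \<longleftrightarrow> (\<forall>x\<in>- zero_set N. \<forall>y\<in>- zero_set N. ang x y + ang (- x) y = pi)"

definition An8 :: "('a :: real_vector \<Rightarrow> real) \<Rightarrow> ('a \<Rightarrow> 'a \<Rightarrow> real) \<Rightarrow> bool" where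
  "An8 N ang \<longleftrightarrow>
    (\<forall>x\<in>- zero_set N. \<forall>y\<in>- zero_set N. x + y \<in> - zero_set N \<longrightarrow>
      ang x (x + y) + ang (x + y) y = ang x y)"

definition An9 :: "('a :: real_vector \<Rightarrow> real) \<Rightarrow> ('a \<Rightarrow> 'a \<Rightarrow> real) \<Rightarrow> bool" where
  "An9 N ang \<longleftrightarrow>
    (\<forall>x\<in>- zero_set N. \<forall>y\<in>- zero_set N. x - y \<in> - zero_set N \<longrightarrow>
      ang x y + ang (- x) (y - x) + ang (- y) (x - y) = pi)"

definition An10 :: "('a :: real_vector \<Rightarrow> real) \<Rightarrow> ('a \<Rightarrow> 'a \<Rightarrow> real) \<Rightarrow> bool" where
  "An10 N ang \<longleftrightarrow>
    (\<forall>x\<in>- zero_set N. \<forall>y\<in>- zero_set N. x - y \<in> - zero_set N \<longrightarrow>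
      ang y (y - x) + ang x (x - y) = ang (- x) y)"

text \<open>In \<open>An11\<close>, \<open>x \<noteq> y\<close> is needed because \<open>{x, y}\<close> is a set, and the first conjunct of the
  conclusion is the well-definedness of the assignment.\<close>

definition An11 :: "('a :: real_vector \<Rightarrow> real) \<Rightarrow> ('a \<Rightarrow> 'a \<Rightarrow> real) \<Rightarrow> bool" where
  "An11 N ang \<longleftrightarrow>
    (\<forall>x\<in>- zero_set N. \<forall>y\<in>- zero_set N. x \<noteq> y \<and> independent {x, y} \<longrightarrow>
      (\<forall>t. y + t *\<^sub>R x \<in> - zero_set N) \<and>
      strict_antimono_on UNIV (\<lambda>t. ang x (y + t *\<^sub>R x)) \<and>
      (\<exists>g. homeomorphism UNIV {0<..<pi} (\<lambda>t. ang x (y + t *\<^sub>R x)) g))"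

definition angle_space ::
    "('a :: real_topological_vector_space \<Rightarrow> real) \<Rightarrow> ('a \<Rightarrow> 'a \<Rightarrow> real) \<Rightarrow> bool" where
  "angle_space N ang \<longleftrightarrow>
    hw_space N \<and> An1 N ang \<and> An2 N ang \<and> An3 N ang \<and> An4 N ang \<and> An5 N ang"

end

theory Submission
  imports Defs
begin

text \<open>Normalising both vectors reduces everything to
  \<open>thy_cos N x y = (N (u + v)\<^sup>2 - N (u - v)\<^sup>2) / 4\<close> with \<open>u = x /\<^sub>R N x\<close>, \<open>v = y /\<^sub>R N y\<close>: the Thy angle
  is its arc cosine.  Since \<open>N u = N v = 1\<close>, the triangle inequality puts both squares into \<open>[0, 4]\<close>,
  which is the CSB inequality.  The cosine is symmetric, depends only on the rays of its arguments,
  is 1 on the diagonal, and changes sign when one argument is negated, because this swaps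
  \<open>N (u + v)\<close> and \<open>N (u - v)\<close>; so (An 2) to (An 7) follow from properties of \<open>arccos\<close>.
  Continuity is that of the vector space operations, of \<open>N\<close> and of \<open>arccos\<close> on \<open>[-1, 1]\<close>.  For an inner product the polarisation identity
  gives back the inner product.

  For the negative part, replacing \<open>y\<close> by \<open>- y\<close> and using (An 4), (An 6) and (An 7) turns (An 8)
  into (An 10), and (An 10) into (An 9).  So the three conditions stand or fall together
  (\<open>An8_iff_An10\<close>, \<open>An9_iff_An10\<close>), and a single normed plane refutes all of them: in the maximum
  norm the coordinate axes are at a right angle, but each makes the angle \<open>arccos (3/4)\<close> with the
  diagonal, and \<open>2 * arccos (3/4) \<noteq> pi / 2\<close>.  (An 11) fails for a seminorm with nontrivial zero-set,
  because a line \<open>y + t x\<close> with \<open>y\<close> linearly independent of \<open>x\<close> may meet the zero-set.\<close>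

section \<open>The cosine of the Thy angle\<close>

definition thy_cos :: "('a :: real_vector \<Rightarrow> real) \<Rightarrow> 'a \<Rightarrow> 'a \<Rightarrow> real" where
  "thy_cos N x y =
    ((N (x /\<^sub>R N x + y /\<^sub>R N y))\<^sup>2 - (N (x /\<^sub>R N x - y /\<^sub>R N y))\<^sup>2) / 4"

lemma spade_product_eq_thy_cos:
  assumes "N x \<noteq> 0" "N y \<noteq> 0"
  shows "spade_product N x y = N x * N y * thy_cos N x y"
  using assms by (simp add: spade_product_def thy_cos_def)

lemma thy_angle_eq_arccos:
  assumes "N x \<noteq> 0" "N y \<noteq> 0"
  shows "thy_angle N x y = arccos (thy_cos N x y)"
  using assms by (simp add: thy_angle_def spade_product_eq_thy_cos)

lemma mem_zero_set [simp]: "x \<in> zero_set N \<longleftrightarrow> N x = 0"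
  by (simp add: zero_set_def)

context hw_space
begin

lemma weight_uminus [simp]: "N (- x) = N x"
  using weight_scaleR[of "- 1" x] by simp

lemma weight_minus_commute: "N (x - y) = N (y - x)"
  using weight_uminus[of "x - y"] by simp

lemma weight_zero [simp]: "N 0 = 0"
  using weight_scaleR[of 0 0] by simp

lemma weight_normalized:
  assumes "N x \<noteq> 0"
  shows "N (x /\<^sub>R N x) = 1"
  using assms weight_nonneg[of x] by (simp add: weight_scaleR)

lemma normalized_scaleR:
  assumes "r > 0"
  shows "(r *\<^sub>R x) /\<^sub>R N (r *\<^sub>R x) = x /\<^sub>R N x"
  using assms by (simp add: weight_scaleR)

lemma thy_cos_commute: "thy_cos N x y = thy_cos N y x"
  by (simp add: thy_cos_def add.commute weight_minus_commute[of "x /\<^sub>R N x"])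

lemma thy_cos_scaleR:
  assumes "r > 0" "s > 0"
  shows "thy_cos N (r *\<^sub>R x) (s *\<^sub>R y) = thy_cos N x y"
  using assms by (simp only: thy_cos_def normalized_scaleR)

lemma thy_cos_uminus_left: "thy_cos N (- x) y = - thy_cos N x y"
proof -
  have "N (- (x /\<^sub>R N x) + y /\<^sub>R N y) = N (x /\<^sub>R N x - y /\<^sub>R N y)"
    using weight_minus_commute[of "x /\<^sub>R N x" "y /\<^sub>R N y"] by simp
  moreover have "N (- (x /\<^sub>R N x) - y /\<^sub>R N y) = N (x /\<^sub>R N x + y /\<^sub>R N y)"
    using weight_uminus[of "x /\<^sub>R N x + y /\<^sub>R N y"] by simp
  ultimately show ?thesis
    by (simp add: thy_cos_def field_simps)
qed

lemma thy_cos_uminus_uminus: "thy_cos N (- x) (- y) = thy_cos N x y"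
  by (metis thy_cos_commute thy_cos_uminus_left minus_minus)

lemma thy_cos_self:
  assumes "N x \<noteq> 0"
  shows "thy_cos N x x = 1"
proof -
  have "N (x /\<^sub>R N x + x /\<^sub>R N x) = 2"
    using weight_scaleR[of 2 "x /\<^sub>R N x"] weight_normalized[OF assms]
    by (simp only: scaleR_2)
  then show ?thesis
    by (simp add: thy_cos_def)
qed

end

section \<open>The Thy angle of a seminorm\<close>

context seminormed_space
begin

text \<open>A sum or difference of two vectors of weight 1 has weight at most 2, and the two squares enter
  with opposite signs.\<close>

lemma abs_thy_cos_le_1:
  assumes "N x \<noteq> 0" "N y \<noteq> 0"
  shows "\<bar>thy_cos N x y\<bar> \<le> 1"
proof -
  define u v where "u = x /\<^sub>R N x" and "v = y /\<^sub>R N y"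
  have unit: "N u = 1" "N v = 1"
    unfolding u_def v_def using assms by (blast intro: weight_normalized)+
  have "N (u + v) \<le> 2" "N (u - v) \<le> 2"
    using weight_triangle[of u v] weight_triangle[of u "- v"] unit by simp_all
  then have "(N (u + v))\<^sup>2 \<le> 4" "(N (u - v))\<^sup>2 \<le> 4"
    using power_mono[of _ "2 :: real" 2] weight_nonneg by fastforce+
  moreover have "\<bar>(a - b) / 4\<bar> \<le> 1" if "0 \<le> a" "0 \<le> b" "a \<le> 4" "b \<le> 4" for a b :: real
    using that by (simp add: abs_le_iff)
  ultimately show ?thesis
    unfolding thy_cos_def u_def[symmetric] v_def[symmetric] by simp
qed

lemma thy_cos_bounds:
  assumes "N x \<noteq> 0" "N y \<noteq> 0"
  shows "- 1 \<le> thy_cos N x y" "thy_cos N x y \<le> 1"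
  using abs_thy_cos_le_1[OF assms] by linarith+

lemma CSB_spade_product: "CSB_inequality N (spade_product N)"
  unfolding CSB_inequality_def
proof (intro allI)
  fix x y
  show "\<bar>spade_product N x y\<bar> \<le> N x * N y"
  proof (cases "N x * N y = 0")
    case True
    then show ?thesis
      by (simp add: spade_product_def weight_nonneg)
  next
    case False
    then have "N x \<noteq> 0" "N y \<noteq> 0"
      by auto
    then show ?thesis
      by (simp add: spade_product_eq_thy_cos abs_mult weight_nonneg mult_left_le abs_thy_cos_le_1)
  qed
qed

lemma thy_angle_defined:
  assumes "N x * N y \<noteq> 0"
  shows "thy_angle_defined N x y"
  using assms CSB_spade_product
  by (auto simp: thy_angle_defined_def zero_set_def CSB_inequality_def)

end

text \<open>The axiom of the class in the form that composes with the other limit rules.\<close>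

lemma tendsto_scaleR_tvs:
  fixes g :: "'b \<Rightarrow> 'a :: real_topological_vector_space"
  assumes "(f \<longlongrightarrow> a) F" "(g \<longlongrightarrow> b) F"
  shows "((\<lambda>z. f z *\<^sub>R g z) \<longlongrightarrow> a *\<^sub>R b) F"
  using filterlim_compose[OF tendsto_scaleR_Pair filterlim_Pair[OF assms]] by simp

lemma continuous_on_scaleR_tvs:
  fixes g :: "'b :: topological_space \<Rightarrow> 'a :: real_topological_vector_space"
  assumes "continuous_on S f" "continuous_on S g"
  shows "continuous_on S (\<lambda>z. f z *\<^sub>R g z)"
  using assms unfolding continuous_on_def by (blast intro: tendsto_scaleR_tvs)

context seminormed_space
begin

lemma continuous_on_thy_cos:
  "continuous_on ((- zero_set N) \<times> (- zero_set N)) (\<lambda>z. thy_cos N (fst z) (snd z))"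
proof -
  let ?S = "(- zero_set N) \<times> (- zero_set N)"
  have weight: "continuous_on ?S (\<lambda>z. N (f z))" if "continuous_on ?S f" for f :: "'a \<times> 'a \<Rightarrow> 'a"
    using continuous_on_compose2[OF continuous_weight that] by simp
  have normalized: "continuous_on ?S (\<lambda>z. f z /\<^sub>R N (f z))"
    if "continuous_on ?S f" "\<And>z. z \<in> ?S \<Longrightarrow> N (f z) \<noteq> 0" for f :: "'a \<times> 'a \<Rightarrow> 'a"
    using that by (intro continuous_on_scaleR_tvs continuous_on_inverse weight) auto
  have "continuous_on ?S (\<lambda>z. fst z /\<^sub>R N (fst z))" "continuous_on ?S (\<lambda>z. snd z /\<^sub>R N (snd z))"
    by (rule normalized; auto intro: continuous_intros)+
  then show ?thesis
    unfolding thy_cos_def by (intro continuous_intros weight) auto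
qed

lemma An1_thy_angle: "An1 N (thy_angle N)"
proof -
  let ?S = "(- zero_set N) \<times> (- zero_set N)"
  have "continuous_on ?S (\<lambda>z. arccos (thy_cos N (fst z) (snd z)))"
    by (intro continuous_on_arccos continuous_on_thy_cos) (auto simp: thy_cos_bounds)
  then have "continuous_on ?S (\<lambda>(x, y). thy_angle N x y)"
    by (rule continuous_on_eq) (auto simp: thy_angle_eq_arccos)
  then show ?thesis
    by (auto simp: An1_def thy_angle_eq_arccos thy_cos_bounds arccos_lbound arccos_ubound)
qed

lemma An2_thy_angle: "An2 N (thy_angle N)"
  by (simp add: An2_def thy_angle_eq_arccos thy_cos_self)

lemma An3_thy_angle: "An3 N (thy_angle N)"
  by (simp add: An3_def thy_angle_eq_arccos thy_cos_uminus_left thy_cos_self)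

lemma An4_thy_angle: "An4 N (thy_angle N)"
  by (simp add: An4_def thy_angle_eq_arccos thy_cos_commute)

lemma An5_thy_angle: "An5 N (thy_angle N)"
  by (simp add: An5_def thy_angle_eq_arccos weight_scaleR thy_cos_scaleR)

lemma An6_thy_angle: "An6 N (thy_angle N)"
  by (simp add: An6_def thy_angle_eq_arccos thy_cos_uminus_uminus)

lemma An7_thy_angle: "An7 N (thy_angle N)"
  by (simp add: An7_def thy_angle_eq_arccos thy_cos_uminus_left arccos_minus thy_cos_bounds)

lemma angle_space_thy_angle: "angle_space N (thy_angle N)"
  by (simp add: angle_space_def hw_space_axioms An1_thy_angle An2_thy_angle An3_thy_angle
      An4_thy_angle An5_thy_angle)

end

section \<open>Inner product spaces\<close>

lemma polarization: "(norm (x + y))\<^sup>2 - (norm (x - y))\<^sup>2 = 4 * inner x y"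
  by (simp add: power2_norm_eq_inner inner_simps inner_commute)

lemma spade_product_norm: "spade_product norm x y = inner x y"
  by (cases "x = 0 \<or> y = 0") (auto simp: spade_product_def polarization field_simps)

lemma CSB_inner: "CSB_inequality norm inner"
  by (simp add: CSB_inequality_def Cauchy_Schwarz_ineq2)

lemma thy_angle_norm: "thy_angle norm x y = euclid_angle x y"
  by (simp add: thy_angle_def euclid_angle_def spade_product_norm)

lemma thy_angle_defined_norm:
  fixes x y :: "'a :: real_inner"
  assumes "x \<noteq> 0" "y \<noteq> 0"
  shows "thy_angle_defined norm x y"
  using assms
  by (simp add: thy_angle_defined_def zero_set_def spade_product_norm Cauchy_Schwarz_ineq2)

section \<open>Equivalence of the three additivity conditions\<close>

context hw_space
begin

text \<open>(An 8) at \<open>x, - y\<close> becomes (An 10) at \<open>x, y\<close>, once (An 6) moves the minus sign and (An 4)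
  exchanges the arguments.\<close>

lemma An8_iff_An10:
  assumes "An4 N ang" "An6 N ang"
  shows "An8 N ang \<longleftrightarrow> An10 N ang"
proof -
  have commute: "ang x y = ang y x" if "N x \<noteq> 0" "N y \<noteq> 0" for x y
    using that assms(1) by (simp add: An4_def)
  have opposite: "ang (- x) (- y) = ang x y" if "N x \<noteq> 0" "N y \<noteq> 0" for x y
    using that assms(2) by (simp add: An6_def)
  have shift: "(ang x (x + - y) + ang (x + - y) (- y) = ang x (- y)) \<longleftrightarrow>
      (ang y (y - x) + ang x (x - y) = ang (- x) y)"
    if "N x \<noteq> 0" "N y \<noteq> 0" "N (x - y) \<noteq> 0" for x y
  proof -
    have "N (y - x) \<noteq> 0"
      using that weight_minus_commute[of x y] by simp
    then have "ang (x - y) (- y) = ang y (y - x)"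
      using that opposite[of "y - x" y] commute[of y "y - x"] by simp
    moreover have "ang x (- y) = ang (- x) y"
      using that opposite[of "- x" y] by simp
    ultimately show ?thesis
      by (simp add: add.commute)
  qed
  have "An8 N ang \<longleftrightarrow> (\<forall>x y. N x \<noteq> 0 \<longrightarrow> N (- y) \<noteq> 0 \<longrightarrow> N (x + - y) \<noteq> 0 \<longrightarrow>
      ang x (x + - y) + ang (x + - y) (- y) = ang x (- y))"
    unfolding An8_def Ball_def Compl_iff mem_zero_set by (metis minus_minus)
  also have "\<dots> \<longleftrightarrow> An10 N ang"
    unfolding An10_def Ball_def Compl_iff mem_zero_set using shift by simp
  finally show ?thesis .
qed

text \<open>(An 6) turns the last two summands of (An 9) into the left side of (An 10), and by (An 7) the
  angle that remains is the supplement of the right side.\<close>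

lemma An9_iff_An10:
  assumes "An6 N ang" "An7 N ang"
  shows "An9 N ang \<longleftrightarrow> An10 N ang"
proof -
  have "(ang x y + ang (- x) (y - x) + ang (- y) (x - y) = pi) \<longleftrightarrow>
      (ang y (y - x) + ang x (x - y) = ang (- x) y)"
    if "N x \<noteq> 0" "N y \<noteq> 0" "N (x - y) \<noteq> 0" for x y
  proof -
    have "N (y - x) \<noteq> 0"
      using that weight_minus_commute[of x y] by simp
    then have "ang (- x) (- (x - y)) = ang x (x - y)" "ang (- y) (- (y - x)) = ang y (y - x)"
      using that assms(1) unfolding An6_def Ball_def Compl_iff mem_zero_set by blast+
    moreover have "ang x y + ang (- x) y = pi"
      using that assms(2) by (simp add: An7_def)
    ultimately show ?thesis
      by simp linarith
  qed
  then show ?thesis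
    by (simp add: An9_def An10_def)
qed

end

section \<open>Counterexamples in the plane\<close>

lemma normed_space_infnorm: "normed_space (infnorm :: 'a :: euclidean_space \<Rightarrow> real)"
proof
  show "continuous_on UNIV (infnorm :: 'a \<Rightarrow> real)"
    by (simp add: continuous_on_def tendsto_infnorm)
qed (simp_all add: infnorm_pos_le infnorm_mul infnorm_triangle infnorm_eq_0)

text \<open>\<open>cos (2 * arccos (3/4)) = 2 * (3/4)\<^sup>2 - 1 = 1/8\<close>, whereas a right angle has cosine 0.\<close>

lemma not_An8_infnorm: "\<not> An8 infnorm (thy_angle (infnorm :: real ^ 2 \<Rightarrow> real))"
proof
  assume An8: "An8 infnorm (thy_angle (infnorm :: real ^ 2 \<Rightarrow> real))"
  define x y :: "real ^ 2" where "x = vector [1, 0]" and "y = vector [0, 1]"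
  have weight: "infnorm x = 1" "infnorm y = 1" "infnorm (x + y) = 1"
    by (simp_all add: infnorm_2 x_def y_def)
  have cosines: "thy_cos infnorm x y = 0" "thy_cos infnorm x (x + y) = 3 / 4"
      "thy_cos infnorm (x + y) y = 3 / 4"
    unfolding thy_cos_def weight
    by (simp_all add: infnorm_2 x_def y_def power2_eq_square)
  have angles: "thy_angle infnorm x y = pi / 2" "thy_angle infnorm x (x + y) = arccos (3 / 4)"
      "thy_angle infnorm (x + y) y = arccos (3 / 4)"
    by (simp_all only: thy_angle_eq_arccos weight cosines) simp_all
  have "thy_angle infnorm x (x + y) + thy_angle infnorm (x + y) y = thy_angle infnorm x y"
    using An8 weight unfolding An8_def by simp
  then have "2 * arccos (3 / 4) = pi / 2"
    unfolding angles by simp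
  then have "cos (2 * arccos (3 / 4)) = 0"
    by (simp only: cos_pi_half)
  then show False
    by (simp add: cos_double_cos power2_eq_square)
qed

lemma not_An9_not_An10_infnorm:
  "\<not> An9 infnorm (thy_angle (infnorm :: real ^ 2 \<Rightarrow> real))"
  "\<not> An10 infnorm (thy_angle (infnorm :: real ^ 2 \<Rightarrow> real))"
proof -
  interpret normed_space "infnorm :: real ^ 2 \<Rightarrow> real"
    by (rule normed_space_infnorm)
  show "\<not> An10 infnorm (thy_angle (infnorm :: real ^ 2 \<Rightarrow> real))"
    using not_An8_infnorm An8_iff_An10[OF An4_thy_angle An6_thy_angle] by simp
  then show "\<not> An9 infnorm (thy_angle (infnorm :: real ^ 2 \<Rightarrow> real))"
    using An9_iff_An10[OF An6_thy_angle An7_thy_angle] by simp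
qed

lemma seminormed_space_abs_coordinate:
  "seminormed_space (\<lambda>x :: real ^ 'n. \<bar>x $ i\<bar>)"
  by standard (auto intro!: continuous_intros simp: abs_mult abs_triangle_ineq)

text \<open>With \<open>x = (1, 0)\<close> and \<open>y = (1, 1)\<close> the line \<open>y + t x\<close> meets the zero-set of the first
  coordinate at \<open>t = - 1\<close>, so that the assignment of (An 11) is not well defined.\<close>

lemma not_An11_abs_coordinate: "\<not> An11 (\<lambda>x :: real ^ 2. \<bar>x $ 1\<bar>) ang"
proof
  assume An11: "An11 (\<lambda>x :: real ^ 2. \<bar>x $ 1\<bar>) ang"
  define x y :: "real ^ 2" where "x = vector [1, 0]" and "y = vector [1, 1]"
  have coordinates: "x $ 1 = 1" "x $ 2 = 0" "y $ 1 = 1" "y $ 2 = 1"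
    by (simp_all add: x_def y_def)
  have "x \<noteq> y"
    using coordinates by auto
  moreover have "independent {x, y}"
  proof -
    have "y \<noteq> 0" "x \<notin> span {y}"
      using coordinates by (auto simp: span_singleton)
    then show ?thesis
      using \<open>x \<noteq> y\<close> by (simp add: independent_insert)
  qed
  ultimately have "y + t *\<^sub>R x \<in> - zero_set (\<lambda>x :: real ^ 2. \<bar>x $ 1\<bar>)" for t
    using An11 coordinates unfolding An11_def Ball_def Compl_iff mem_zero_set
    by (metis abs_one zero_neq_one)
  from this[of "- 1"] show False
    using coordinates by simp
qed

section \<open>Properties of the Thy angle\<close>

theorem proposition1:
  shows
    "(\<forall>N :: 'a :: real_topological_vector_space \<Rightarrow> real. seminormed_space N \<longrightarrow>
        CSB_inequality N (spade_product N) \<and>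
        (\<forall>x y. N x * N y \<noteq> 0 \<longrightarrow> thy_angle_defined N x y)) \<and>
     (\<forall>N :: 'a \<Rightarrow> real. seminormed_space N \<longrightarrow>
        An1 N (thy_angle N) \<and> An2 N (thy_angle N) \<and> An3 N (thy_angle N) \<and>
        An4 N (thy_angle N) \<and> An5 N (thy_angle N) \<and>
        angle_space N (thy_angle N)) \<and>
     (\<forall>N :: 'a \<Rightarrow> real. seminormed_space N \<longrightarrow>
        An6 N (thy_angle N) \<and> An7 N (thy_angle N)) \<and>
     (CSB_inequality norm (inner :: 'b :: real_inner \<Rightarrow> 'b \<Rightarrow> real) \<and>
        (\<forall>x y :: 'b. x \<noteq> 0 \<and> y \<noteq> 0 \<longrightarrow>
          thy_angle_defined norm x y \<and> thy_angle norm x y = euclid_angle x y)) \<and>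
     ((\<exists>N :: real ^ 2 \<Rightarrow> real. normed_space N \<and> \<not> An8 N (thy_angle N)) \<and>
      (\<exists>N :: real ^ 2 \<Rightarrow> real. normed_space N \<and> \<not> An9 N (thy_angle N)) \<and>
      (\<exists>N :: real ^ 2 \<Rightarrow> real. normed_space N \<and> \<not> An10 N (thy_angle N))) \<and>
     ((\<exists>N :: real ^ 2 \<Rightarrow> real. seminormed_space N \<and> \<not> An8 N (thy_angle N)) \<and>
      (\<exists>N :: real ^ 2 \<Rightarrow> real. seminormed_space N \<and> \<not> An9 N (thy_angle N)) \<and>
      (\<exists>N :: real ^ 2 \<Rightarrow> real. seminormed_space N \<and> \<not> An10 N (thy_angle N)) \<and>
      (\<exists>N :: real ^ 2 \<Rightarrow> real. seminormed_space N \<and> \<not> An11 N (thy_angle N)))"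
proof (intro conjI allI impI)
  fix N :: "'a \<Rightarrow> real" and x y
  assume "seminormed_space N"
  then interpret seminormed_space N .
  show "CSB_inequality N (spade_product N)" "An1 N (thy_angle N)" "An2 N (thy_angle N)"
    "An3 N (thy_angle N)" "An4 N (thy_angle N)" "An5 N (thy_angle N)" "An6 N (thy_angle N)"
    "An7 N (thy_angle N)" "angle_space N (thy_angle N)"
    by (fact CSB_spade_product An1_thy_angle An2_thy_angle An3_thy_angle An4_thy_angle
        An5_thy_angle An6_thy_angle An7_thy_angle angle_space_thy_angle)+
  show "thy_angle_defined N x y" if "N x * N y \<noteq> 0"
    using that by (rule thy_angle_defined)
next
  show "CSB_inequality norm (inner :: 'b \<Rightarrow> 'b \<Rightarrow> real)"
    by (rule CSB_inner)
next
  fix x y :: 'b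
  assume "x \<noteq> 0 \<and> y \<noteq> 0"
  then show "thy_angle_defined norm x y" "thy_angle norm x y = euclid_angle x y"
    by (simp_all add: thy_angle_defined_norm thy_angle_norm)
next
  have seminormed: "seminormed_space (infnorm :: real ^ 2 \<Rightarrow> real)"
    using normed_space_infnorm by (rule normed_space.axioms)
  note infnorm_counterexamples = not_An8_infnorm not_An9_not_An10_infnorm
  show "\<exists>N :: real ^ 2 \<Rightarrow> real. normed_space N \<and> \<not> An8 N (thy_angle N)"
    "\<exists>N :: real ^ 2 \<Rightarrow> real. normed_space N \<and> \<not> An9 N (thy_angle N)"
    "\<exists>N :: real ^ 2 \<Rightarrow> real. normed_space N \<and> \<not> An10 N (thy_angle N)"
    using normed_space_infnorm infnorm_counterexamples by blast+
  show "\<exists>N :: real ^ 2 \<Rightarrow> real. seminormed_space N \<and> \<not> An8 N (thy_angle N)"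
    "\<exists>N :: real ^ 2 \<Rightarrow> real. seminormed_space N \<and> \<not> An9 N (thy_angle N)"
    "\<exists>N :: real ^ 2 \<Rightarrow> real. seminormed_space N \<and> \<not> An10 N (thy_angle N)"
    using seminormed infnorm_counterexamples by blast+
  show "\<exists>N :: real ^ 2 \<Rightarrow> real. seminormed_space N \<and> \<not> An11 N (thy_angle N)"
    using seminormed_space_abs_coordinate not_An11_abs_coordinate by blast
qed

end
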